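(* Let $n\ge1$. Every static Bogoliubov component is a limit, in the sense of pointwise convergence of transfer functions, of linear Hudson-Parthasarathy systems: for every $\tilde S\in\mathrm{Sp}(\mathbb{C}^n)$ there exists a sequence $(G_k)_{k\ge1}$ of systems in $\mathcal{L}^{\mathrm{HP}}(n)$ such that for every $s\in\mathbb{C}$ the transfer function value $\tilde\Xi_{G_k}(s)$ is defined for all sufficiently large $k$ and $$\lim_{k\to\infty}\tilde\Xi_{G_k}(s)=\tilde S .$$
   Context: For a complex matrix $X$, $X^\#$ is the entrywise complex conjugate and $X^\dagger$ the conjugate transpose. For $E_-,E_+\in\mathbb{C}^{r\times k}$, the doubled-up matrix is $$\Delta(E_-,E_+)=\begin{bmatrix} E_- & E_+ \\ E_+^\# & E_-^\# \end{bmatrix}\in\mathbb{C}^{2r\times2k}.$$ Let $J_n=\begin{bmatrix} I_n & 0 \\ 0 & -I_n \end{bmatrix}$; for a $2n\times2m$ matrix $X$ put $X^\flat=J_mX^\dagger J_n$. $\mathrm{Sp}(\mathbb{C}^n)$ is the group of $2n\times2n$ matrices $\tilde S$ of doubled-up form $\Delta(S_-,S_+)$ with $\tilde S^\flat\tilde S=\tilde S\tilde S^\flat=I$. $\mathcal{L}^{\mathrm{HP}}(n)=\bigcup_{m}\mathcal{L}^{\mathrm{HP}}(n,m)$, where $\mathcal{L}^{\mathrm{HP}}(n,m)$ is the set of triples $G=(S,\tilde C,\tilde\Omega)$ with $S\in\mathbb{C}^{n\times n}$ unitary, $\tilde C=\Delta(C_-,C_+)$ for some $C_\pm\in\mathbb{C}^{n\times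 m}$, and $-i\tilde\Omega=-\Delta(i\Omega_-,i\Omega_+)$ with $\Omega_\pm\in\mathbb{C}^{m\times m}$, $\Omega_-^\dagger=\Omega_-$, $\Omega_+^\top=\Omega_+$. The transfer function of $G$ is $$\tilde\Xi_G(s)=\Delta(S,0)-\tilde C(sI-\tilde A)^{-1}\tilde C^\flat\Delta(S,0),\qquad \tilde A=-\tfrac12\tilde C^\flat\tilde C-i\tilde\Omega,$$ defined for those $s\in\mathbb{C}$ for which $sI-\tilde A$ is invertible. The static Bogoliubov component $\tilde S\in\mathrm{Sp}(\mathbb{C}^n)$ has the constant transfer function $s\mapsto\tilde S$. *)

theory Defs
  imports Complex_Main "Jordan_Normal_Form.Gauss_Jordan_Elimination"
    "Jordan_Normal_Form.Schur_Decomposition"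
begin

definition mat_conj :: "complex mat \<Rightarrow> complex mat" where
  "mat_conj X = map_mat cnj X"

definition Delta :: "complex mat \<Rightarrow> complex mat \<Rightarrow> complex mat" where
  "Delta Em Ep = four_block_mat Em Ep (mat_conj Ep) (mat_conj Em)"

definition Jmat :: "nat \<Rightarrow> complex mat" where
  "Jmat n = four_block_mat (1\<^sub>m n) (0\<^sub>m n n) (0\<^sub>m n n) (- 1\<^sub>m n)"

text \<open>Only meaningful if both dimensions of the argument are even: for a matrix of size
  \<open>2n \<times> 2m\<close> it is \<open>J\<^sub>m X\<^sup>\<dagger> J\<^sub>n\<close>.\<close>
definition mat_flat :: "complex mat \<Rightarrow> complex mat" where
  "mat_flat X = Jmat (dim_col X div 2) * mat_adjoint X * Jmat (dim_row X div 2)"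

definition unitary_matrices :: "nat \<Rightarrow> complex mat set" where
  "unitary_matrices n =
    {S \<in> carrier_mat n n. mat_adjoint S * S = 1\<^sub>m n \<and> S * mat_adjoint S = 1\<^sub>m n}"

definition Sp :: "nat \<Rightarrow> complex mat set" where
  "Sp n = {St. (\<exists>Sm \<in> carrier_mat n n. \<exists>Spl \<in> carrier_mat n n. St = Delta Sm Spl)
      \<and> mat_flat St * St = 1\<^sub>m (2 * n) \<and> St * mat_flat St = 1\<^sub>m (2 * n)}"

text \<open>A system is a triple \<open>(S, C, \<Omega>)\<close> whose last two components are the doubled-up matrices.\<close>
type_synonym hp_system = "complex mat \<times> complex mat \<times> complex mat"

definition LHP_modes :: "nat \<Rightarrow> nat \<Rightarrow> hp_system set" where
  "LHP_modes n m = {(S, C, Om).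
      S \<in> unitary_matrices n
    \<and> (\<exists>Cm \<in> carrier_mat n m. \<exists>Cp \<in> carrier_mat n m. C = Delta Cm Cp)
    \<and> (\<exists>Om_m \<in> carrier_mat m m. \<exists>Om_p \<in> carrier_mat m m.
          mat_adjoint Om_m = Om_m \<and> transpose_mat Om_p = Om_p
        \<and> (- \<i>) \<cdot>\<^sub>m Om = - Delta (\<i> \<cdot>\<^sub>m Om_m) (\<i> \<cdot>\<^sub>m Om_p))}"

definition LHP :: "nat \<Rightarrow> hp_system set" where
  "LHP n = (\<Union>m \<in> {1..}. LHP_modes n m)"

fun A_mat :: "hp_system \<Rightarrow> complex mat" where
  "A_mat (S, C, Om) = (- (1/2)) \<cdot>\<^sub>m (mat_flat C * C) - \<i> \<cdot>\<^sub>m Om"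

definition resolvent_arg :: "hp_system \<Rightarrow> complex \<Rightarrow> complex mat" where
  "resolvent_arg G s = s \<cdot>\<^sub>m 1\<^sub>m (dim_row (A_mat G)) - A_mat G"

definition transfer_defined :: "hp_system \<Rightarrow> complex \<Rightarrow> bool" where
  "transfer_defined G s \<longleftrightarrow> invertible_mat (resolvent_arg G s)"

text \<open>The value is only meaningful where \<^const>\<open>transfer_defined\<close> holds; there
  \<^const>\<open>mat_inverse\<close> returns the inverse.\<close>
fun transfer :: "hp_system \<Rightarrow> complex \<Rightarrow> complex mat" where
  "transfer (S, C, Om) s =
    (let D = Delta S (0\<^sub>m (dim_row S) (dim_col S))
     in D - C * the (mat_inverse (resolvent_arg (S, C, Om) s)) * mat_flat C * D)"

text \<open>Convergence in the (finite-dimensional) space of matrices of the size of \<open>L\<close>.\<close>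
definition mat_tendsto :: "(nat \<Rightarrow> complex mat) \<Rightarrow> complex mat \<Rightarrow> bool" where
  "mat_tendsto X L \<longleftrightarrow>
     (\<forall>\<^sub>F k in sequentially. X k \<in> carrier_mat (dim_row L) (dim_col L))
   \<and> (\<forall>i < dim_row L. \<forall>j < dim_col L. (\<lambda>k. X k $$ (i, j)) \<longlonglongrightarrow> L $$ (i, j))"

end

theory Submission
  imports Defs
begin

text \<open>
  For a unimodular scalar \<open>z\<close> put \<open>D = \<Delta>(z I, 0)\<close>. If \<open>D - S\<close> is invertible, then
  \<open>M = D (D - S)\<^sup>-\<^sup>1\<close> is doubled-up and satisfies \<open>M + M\<^sup>\<flat> = I\<close> (a Cayley transform of \<open>S D\<^sup>-\<^sup>1\<close>), so
  \<open>Z = M - I/2\<close> is \<open>\<flat>\<close>-skew and is \<open>i\<close> times an admissible Hamiltonian matrix. The system with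
  scattering \<open>z I\<close>, coupling \<open>\<surd>k I\<close> and Hamiltonian \<open>-i k Z\<close> has transfer function
  \<open>D - (s/k + M)\<^sup>-\<^sup>1 D\<close>, which tends to \<open>D - M\<^sup>-\<^sup>1 D = S\<close>. A suitable \<open>z\<close> exists because
  \<open>z\<^sup>n det (D - S)\<close> agrees on the unit circle with a polynomial in \<open>z\<close> whose value at \<open>0\<close> is
  \<open>det (- S\<^sub>-)\<close>, and \<open>S\<^sub>-\<^sup>\<dagger> S\<^sub>- = I + S\<^sub>+\<^sup>T S\<^sub>+\<^sup>#\<close> is positive definite.
\<close>

subsection \<open>Adjoints and the flat involution\<close>

lemma index_mat_adjoint [simp]:
  assumes "i < dim_col A" "j < dim_row A"
  shows "mat_adjoint A $$ (i, j) = conjugate (A $$ (j, i))"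
  using assms unfolding mat_adjoint_def by (simp add: mat_of_rows_index)

lemma dim_mat_adjoint [simp]:
  "dim_row (mat_adjoint A) = dim_col A" "dim_col (mat_adjoint A) = dim_row A"
  unfolding mat_adjoint_def by simp_all

lemma mat_adjoint_carrier [simp]: "A \<in> carrier_mat n m \<Longrightarrow> mat_adjoint A \<in> carrier_mat m n"
  by auto

lemma mat_conj_carrier [simp]: "A \<in> carrier_mat n m \<Longrightarrow> mat_conj A \<in> carrier_mat n m"
  by (simp add: mat_conj_def)

lemma dim_mat_conj [simp]: "dim_row (mat_conj A) = dim_row A" "dim_col (mat_conj A) = dim_col A"
  by (simp_all add: mat_conj_def)

lemma index_mat_conj [simp]:
  "i < dim_row A \<Longrightarrow> j < dim_col A \<Longrightarrow> mat_conj A $$ (i, j) = cnj (A $$ (i, j))"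
  by (simp add: mat_conj_def)

lemma mat_conj_mult:
  assumes "A \<in> carrier_mat n m" "B \<in> carrier_mat m l"
  shows "mat_conj (A * B) = mat_conj A * mat_conj B"
  by (rule eq_matI) (use assms in \<open>auto simp: scalar_prod_def\<close>)

lemma Jmat_carrier [simp]: "Jmat n \<in> carrier_mat (n + n) (n + n)"
  by (auto simp: Jmat_def)

lemma index_Jmat:
  "i < n + n \<Longrightarrow> j < n + n \<Longrightarrow> Jmat n $$ (i, j) = (if i = j then if i < n then 1 else - 1 else 0)"
  by (auto simp: Jmat_def)

lemma Jmat_mult_mult_Jmat:
  assumes "X \<in> carrier_mat (n + n) (m + m)" "i < n + n" "j < m + m"
  shows "(Jmat n * X * Jmat m) $$ (i, j)
    = (if i < n then 1 else - 1) * X $$ (i, j) * (if j < m then 1 else - 1)"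
proof -
  have J: "dim_row (Jmat n) = n + n" "dim_col (Jmat n) = n + n" for n
    by (auto simp: Jmat_def)
  show ?thesis
    using assms by (simp add: scalar_prod_def index_Jmat J
        if_distrib[of "\<lambda>x. x * _"] if_distrib[of "\<lambda>x. _ * x"] cong: if_cong)
qed

lemma mat_flat_carrier [simp]:
  "X \<in> carrier_mat (n + n) (m + m) \<Longrightarrow> mat_flat X \<in> carrier_mat (m + m) (n + n)"
  by (auto simp: mat_flat_def Jmat_def)

text \<open>The two J factors only attach signs to the halves of the rows and columns, so identities
  for \<open>mat_flat\<close> reduce to sign bookkeeping on entries. Sizes are written
  \<open>n + n\<close> to match the block decompositions.\<close>

lemma index_mat_flat:
  assumes "X \<in> carrier_mat (n + n) (m + m)" "i < m + m" "j < n + n"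
  shows "mat_flat X $$ (i, j)
    = (if i < m then 1 else - 1) * cnj (X $$ (j, i)) * (if j < n then 1 else - 1)"
proof -
  have "dim_col X div 2 = m" "dim_row X div 2 = n" using assms by auto
  then show ?thesis
    using assms Jmat_mult_mult_Jmat[of "mat_adjoint X" m n i j] by (simp add: mat_flat_def)
qed

text \<open>On the right-hand side the sign of the summation index comes once from each factor and
  squares to 1: the two inner J matrices cancel.\<close>

lemma mat_flat_mult:
  assumes X: "X \<in> carrier_mat (n + n) (m + m)" and Y: "Y \<in> carrier_mat (m + m) (l + l)"
  shows "mat_flat (X * Y) = mat_flat Y * mat_flat X"
proof -
  have XY: "X * Y \<in> carrier_mat (n + n) (l + l)" using assms by auto
  note [simp] = index_mat_flat[OF X] index_mat_flat[OF Y] index_mat_flat[OF XY]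
    carrier_matD[OF X] carrier_matD[OF Y]
    carrier_matD[OF mat_flat_carrier[OF X]] carrier_matD[OF mat_flat_carrier[OF Y]]
    carrier_matD[OF mat_flat_carrier[OF XY]]
  show ?thesis
    by (rule eq_matI) (auto simp: scalar_prod_def sum_negf[symmetric] intro!: sum.cong)
qed

lemma mat_flat_minus:
  assumes X: "X \<in> carrier_mat (n + n) (m + m)" and Y: "Y \<in> carrier_mat (n + n) (m + m)"
  shows "mat_flat (X - Y) = mat_flat X - mat_flat Y"
proof -
  have XY: "X - Y \<in> carrier_mat (n + n) (m + m)" using assms by auto
  note [simp] = index_mat_flat[OF X] index_mat_flat[OF Y] index_mat_flat[OF XY]
    carrier_matD[OF X] carrier_matD[OF Y]
    carrier_matD[OF mat_flat_carrier[OF X]] carrier_matD[OF mat_flat_carrier[OF Y]]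
    carrier_matD[OF mat_flat_carrier[OF XY]]
  show ?thesis by (rule eq_matI) (auto simp: algebra_simps)
qed

lemma mat_flat_one: "mat_flat (1\<^sub>m (n + n)) = 1\<^sub>m (n + n)"
proof -
  have "1\<^sub>m (n + n) \<in> carrier_mat (n + n) (n + n)" by simp
  from index_mat_flat[OF this] carrier_matD[OF mat_flat_carrier[OF this]]
  show ?thesis by (intro eq_matI) auto
qed

lemma mat_flat_smult:
  assumes X: "X \<in> carrier_mat (n + n) (m + m)"
  shows "mat_flat (c \<cdot>\<^sub>m X) = cnj c \<cdot>\<^sub>m mat_flat X"
proof -
  have cX: "c \<cdot>\<^sub>m X \<in> carrier_mat (n + n) (m + m)" using assms by auto
  note [simp] = index_mat_flat[OF X] index_mat_flat[OF cX] carrier_matD[OF X]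
    carrier_matD[OF mat_flat_carrier[OF X]] carrier_matD[OF mat_flat_carrier[OF cX]]
  show ?thesis by (rule eq_matI) auto
qed

subsection \<open>Doubled-up matrices\<close>

text \<open>This is the \<Sigma> of the criterion stated next; it is its own inverse.\<close>

definition swap_mat :: "nat \<Rightarrow> complex mat" where
  "swap_mat n = four_block_mat (0\<^sub>m n n) (1\<^sub>m n) (1\<^sub>m n) (0\<^sub>m n n)"

text \<open>Stating \<open>\<Sigma> X\<^sup># \<Sigma> = X\<close> as the intertwining \<open>\<Sigma> X\<^sup># = X \<Sigma>\<close> makes closure under products
  and inverses immediate.\<close>
definition doubled_up :: "nat \<Rightarrow> complex mat \<Rightarrow> bool" where
  "doubled_up n X \<longleftrightarrow> X \<in> carrier_mat (n + n) (n + n) \<and> swap_mat n * mat_conj X = X * swap_mat n"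

lemma swap_mat_carrier [simp]: "swap_mat n \<in> carrier_mat (n + n) (n + n)"
  by (auto simp: swap_mat_def)

lemma mat_conj_four_block:
  assumes "A \<in> carrier_mat n n" "B \<in> carrier_mat n n" "C \<in> carrier_mat n n" "D \<in> carrier_mat n n"
  shows "mat_conj (four_block_mat A B C D)
    = four_block_mat (mat_conj A) (mat_conj B) (mat_conj C) (mat_conj D)"
  using assms unfolding mat_conj_def by (simp add: map_four_block_mat[of _ n n _ n _ n])

lemma mat_conj_mat_conj [simp]: "mat_conj (mat_conj A) = A"
  by (rule eq_matI) auto

lemma doubled_up_Delta:
  assumes "A \<in> carrier_mat n n" "B \<in> carrier_mat n n"
  shows "doubled_up n (Delta A B)"
  using assms unfolding doubled_up_def Delta_def swap_mat_def
  by (simp add: mat_conj_four_block mult_four_block_mat[of _ n n _ n _ n _ _ n _ n])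

text \<open>Converse of \<open>doubled_up_Delta\<close>. In the intertwining relation \<Sigma> swaps
  the block rows of X^# on the left and the block columns of X on the right; comparing the lower
  blocks gives C = B^# and D = A^#.\<close>

lemma doubled_upE:
  assumes "doubled_up n X"
  obtains A B where "A \<in> carrier_mat n n" "B \<in> carrier_mat n n" "X = Delta A B"
proof -
  have X: "X \<in> carrier_mat (n + n) (n + n)" using assms by (simp add: doubled_up_def)
  obtain A B C D where s: "split_block X n n = (A, B, C, D)" by (metis prod_cases4)
  note b = split_block[OF s, of n n]
  have c: "A \<in> carrier_mat n n" "B \<in> carrier_mat n n" "C \<in> carrier_mat n n" "D \<in> carrier_mat n n"
    and e: "X = four_block_mat A B C D"
    using b X by auto
  have "four_block_mat (mat_conj C) (mat_conj D) (mat_conj A) (mat_conj B) = four_block_mat B A D C"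
    using assms c unfolding doubled_up_def e swap_mat_def
    by (simp add: mat_conj_four_block mult_four_block_mat[of _ n n _ n _ n _ _ n _ n])
  then have eq: "four_block_mat (mat_conj C) (mat_conj D) (mat_conj A) (mat_conj B) $$ (i, j)
      = four_block_mat B A D C $$ (i, j)" for i j by simp
  have "C = mat_conj B"
  proof (rule eq_matI)
    fix i j assume "i < dim_row (mat_conj B)" "j < dim_col (mat_conj B)"
    then show "C $$ (i, j) = mat_conj B $$ (i, j)"
      using eq[of "n + i" "n + j"] eq[of i j] c by auto
  qed (use c in auto)
  moreover have "D = mat_conj A"
  proof (rule eq_matI)
    fix i j assume "i < dim_row (mat_conj A)" "j < dim_col (mat_conj A)"
    then show "D $$ (i, j) = mat_conj A $$ (i, j)"
      using eq[of "n + i" j] c by auto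
  qed (use c in auto)
  ultimately have "X = Delta A B" using e by (simp add: Delta_def)
  with c that show thesis by blast
qed

lemma doubled_up_mult:
  assumes "doubled_up n X" "doubled_up n Y"
  shows "doubled_up n (X * Y)"
proof -
  let ?N = "n + n"
  have X: "X \<in> carrier_mat ?N ?N" "swap_mat n * mat_conj X = X * swap_mat n"
    and Y: "Y \<in> carrier_mat ?N ?N" "swap_mat n * mat_conj Y = Y * swap_mat n"
    using assms by (auto simp: doubled_up_def)
  have "swap_mat n * mat_conj (X * Y) = swap_mat n * mat_conj X * mat_conj Y"
    using X(1) Y(1) by (simp add: mat_conj_mult[of _ ?N ?N _ ?N] assoc_mult_mat[of _ ?N ?N _ ?N _ ?N])
  also have "\<dots> = X * (swap_mat n * mat_conj Y)"
    unfolding X(2) using X(1) Y(1) by (simp add: assoc_mult_mat[of _ ?N ?N _ ?N _ ?N])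
  also have "\<dots> = X * Y * swap_mat n"
    unfolding Y(2) using X(1) Y(1) by (simp add: assoc_mult_mat[of _ ?N ?N _ ?N _ ?N])
  finally show ?thesis using X(1) Y(1) by (simp add: doubled_up_def)
qed

lemma doubled_up_minus:
  assumes "doubled_up n X" "doubled_up n Y"
  shows "doubled_up n (X - Y)"
proof -
  let ?N = "n + n"
  have X: "X \<in> carrier_mat ?N ?N" "swap_mat n * mat_conj X = X * swap_mat n"
    and Y: "Y \<in> carrier_mat ?N ?N" "swap_mat n * mat_conj Y = Y * swap_mat n"
    using assms by (auto simp: doubled_up_def)
  have "mat_conj (X - Y) = mat_conj X - mat_conj Y"
    by (rule eq_matI) (use X Y in auto)
  then show ?thesis
    using X Y by (simp add: doubled_up_def mult_minus_distrib_mat[of _ ?N ?N _ ?N]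
        minus_mult_distrib_mat[of _ ?N ?N _ _ ?N] minus_carrier_mat[of Y ?N ?N])
qed

text \<open>Insert Y X in front of \<Sigma> Y^#, move \<Sigma> across X by the intertwining, and
  cancel X^# Y^# = I.\<close>

lemma doubled_up_inverse:
  assumes X: "doubled_up n X" and Y: "Y \<in> carrier_mat (n + n) (n + n)"
    and inv: "X * Y = 1\<^sub>m (n + n)" "Y * X = 1\<^sub>m (n + n)"
  shows "doubled_up n Y"
proof -
  let ?N = "n + n" and ?J = "swap_mat n"
  note [simp] = assoc_mult_mat[of _ ?N ?N _ ?N _ ?N] mult_carrier_mat[of _ ?N ?N _ ?N]
  have X': "X \<in> carrier_mat ?N ?N" "?J * mat_conj X = X * ?J"
    using X by (auto simp: doubled_up_def)
  have one: "mat_conj (1\<^sub>m ?N) = 1\<^sub>m ?N" by (rule eq_matI) auto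
  have c: "mat_conj X * mat_conj Y = 1\<^sub>m ?N"
    using inv(1) mat_conj_mult[OF X'(1) Y] one by simp
  have "?J * mat_conj Y = (Y * X) * (?J * mat_conj Y)"
    unfolding inv by (rule left_mult_one_mat[symmetric]) (use Y in \<open>auto intro!: mult_carrier_mat\<close>)
  also have "\<dots> = Y * (X * ?J) * mat_conj Y" using X'(1) Y by simp
  also have "\<dots> = Y * ?J * (mat_conj X * mat_conj Y)"
    unfolding X'(2)[symmetric] using X'(1) Y by simp
  also have "\<dots> = Y * ?J" using Y unfolding c by (simp add: right_mult_one_mat[OF swap_mat_carrier])
  finally show ?thesis using Y by (simp add: doubled_up_def)
qed

text \<open>Translates flat-skewness into block conditions of the kind that \<open>LHP_modes\<close>
  asks for. In the upper right block the sign contributed by J cancels the sign of skewness, which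
  leaves symmetry of B.\<close>

lemma mat_adjoint_eq_neg_flat_Delta:
  assumes A: "A \<in> carrier_mat n n" and B: "B \<in> carrier_mat n n"
    and skew: "mat_flat (Delta A B) = - Delta A B"
  shows "mat_adjoint A = - A" "transpose_mat B = B"
proof -
  have D: "Delta A B \<in> carrier_mat (n + n) (n + n)" using A B by (auto simp: Delta_def)
  have eq: "mat_flat (Delta A B) $$ (i, j) = (- Delta A B) $$ (i, j)" for i j using skew by simp
  show "mat_adjoint A = - A"
  proof (rule eq_matI)
    fix i j assume "i < dim_row (- A)" "j < dim_col (- A)"
    then show "mat_adjoint A $$ (i, j) = (- A) $$ (i, j)"
      using A B D eq[of i j] by (simp add: index_mat_flat[OF D]) (simp add: Delta_def)
  qed (use A in auto)
  show "transpose_mat B = B"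
  proof (rule eq_matI)
    fix i j assume "i < dim_row B" "j < dim_col B"
    then show "transpose_mat B $$ (i, j) = B $$ (i, j)"
      using A B D eq[of i "n + j"] by (simp add: index_mat_flat[OF D]) (simp add: Delta_def)
  qed (use B in auto)
qed

subsection \<open>Continuity of the determinant and of the inverse\<close>

text \<open>The Leibniz formula makes the determinant a polynomial in the entries. It applies to
  \<open>X k\<close> only once that matrix has the size of \<open>L\<close>, hence the eventual
  equality.\<close>

lemma mat_tendsto_det:
  assumes X: "mat_tendsto X L" and L: "L \<in> carrier_mat N N"
  shows "(\<lambda>k. det (X k)) \<longlonglongrightarrow> det L"
proof -
  have "(\<lambda>k. \<Sum>p\<in>{p. p permutes {0..<N}}. signof p * (\<Prod>i = 0..<N. X k $$ (i, p i)))
      \<longlonglongrightarrow> (\<Sum>p\<in>{p. p permutes {0..<N}}. signof p * (\<Prod>i = 0..<N. L $$ (i, p i)))"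
    using X L unfolding mat_tendsto_def
    by (intro tendsto_intros) (auto simp: permutes_in_image dest: permutes_in_image)
  moreover have "\<forall>\<^sub>F k in sequentially. (\<Sum>p\<in>{p. p permutes {0..<N}}. signof p * (\<Prod>i = 0..<N. X k $$ (i, p i))) = det (X k)"
    using X L unfolding mat_tendsto_def
    by (auto simp: det_def'[of _ N] elim!: eventually_mono)
  ultimately show ?thesis
    using L by (auto simp: det_def'[of L N] intro: Lim_transform_eventually)
qed

lemma mat_tendsto_const [simp]: "mat_tendsto (\<lambda>k. L) L"
  by (simp add: mat_tendsto_def)

lemma mat_tendsto_cong:
  assumes "mat_tendsto X L" "\<forall>\<^sub>F k in sequentially. X k = Y k"
  shows "mat_tendsto Y L"
proof -
  have "\<forall>\<^sub>F k in sequentially. Y k \<in> carrier_mat (dim_row L) (dim_col L)"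
    using assms unfolding mat_tendsto_def by (auto elim: eventually_elim2)
  moreover have "(\<lambda>k. Y k $$ (i, j)) \<longlonglongrightarrow> L $$ (i, j)" if "i < dim_row L" "j < dim_col L" for i j
  proof (rule Lim_transform_eventually)
    show "(\<lambda>k. X k $$ (i, j)) \<longlonglongrightarrow> L $$ (i, j)" using assms(1) that by (simp add: mat_tendsto_def)
    show "\<forall>\<^sub>F k in sequentially. X k $$ (i, j) = Y k $$ (i, j)"
      using assms(2) by eventually_elim simp
  qed
  ultimately show ?thesis by (simp add: mat_tendsto_def)
qed

lemma mat_tendsto_minus:
  assumes X: "mat_tendsto X L" and Y: "mat_tendsto Y K"
    and "L \<in> carrier_mat n m" "K \<in> carrier_mat n m"
  shows "mat_tendsto (\<lambda>k. X k - Y k) (L - K)"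
  unfolding mat_tendsto_def
proof (intro conjI allI impI)
  have ev: "\<forall>\<^sub>F k in sequentially. Y k \<in> carrier_mat n m"
    using assms by (auto simp: mat_tendsto_def)
  then show "\<forall>\<^sub>F k in sequentially. X k - Y k \<in> carrier_mat (dim_row (L - K)) (dim_col (L - K))"
    by eventually_elim (use assms in auto)
  fix i j assume ij: "i < dim_row (L - K)" "j < dim_col (L - K)"
  have "(\<lambda>k. X k $$ (i, j) - Y k $$ (i, j)) \<longlonglongrightarrow> L $$ (i, j) - K $$ (i, j)"
    using assms ij by (auto simp: mat_tendsto_def intro!: tendsto_intros)
  moreover have "\<forall>\<^sub>F k in sequentially. X k $$ (i, j) - Y k $$ (i, j) = (X k - Y k) $$ (i, j)"
    using ev by eventually_elim (use assms ij in auto)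
  ultimately show "(\<lambda>k. (X k - Y k) $$ (i, j)) \<longlonglongrightarrow> (L - K) $$ (i, j)"
    using assms ij by (auto intro: Lim_transform_eventually)
qed

lemma mat_tendsto_mult:
  assumes X: "mat_tendsto X L" and Y: "mat_tendsto Y K"
    and "L \<in> carrier_mat n m" "K \<in> carrier_mat m l"
  shows "mat_tendsto (\<lambda>k. X k * Y k) (L * K)"
  unfolding mat_tendsto_def
proof (intro conjI allI impI)
  have ev: "\<forall>\<^sub>F k in sequentially. X k \<in> carrier_mat n m \<and> Y k \<in> carrier_mat m l"
    using assms by (auto simp: mat_tendsto_def intro: eventually_conj)
  then show "\<forall>\<^sub>F k in sequentially. X k * Y k \<in> carrier_mat (dim_row (L * K)) (dim_col (L * K))"
    by eventually_elim (use assms in auto)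
  fix i j assume ij: "i < dim_row (L * K)" "j < dim_col (L * K)"
  have "(\<lambda>k. \<Sum>h = 0..<m. X k $$ (i, h) * Y k $$ (h, j)) \<longlonglongrightarrow> (\<Sum>h = 0..<m. L $$ (i, h) * K $$ (h, j))"
    using assms ij by (auto simp: mat_tendsto_def intro!: tendsto_intros)
  moreover have "\<forall>\<^sub>F k in sequentially. (\<Sum>h = 0..<m. X k $$ (i, h) * Y k $$ (h, j)) = (X k * Y k) $$ (i, j)"
    using ev by eventually_elim (use assms ij in \<open>auto simp: scalar_prod_def\<close>)
  ultimately show "(\<lambda>k. (X k * Y k) $$ (i, j)) \<longlonglongrightarrow> (L * K) $$ (i, j)"
    using assms ij by (auto simp: scalar_prod_def intro: Lim_transform_eventually)
qed

lemma mat_inverse_unique: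
  fixes A :: "'a :: field mat"
  assumes A: "A \<in> carrier_mat n n" and B: "B \<in> carrier_mat n n" and C: "C \<in> carrier_mat n n"
    and AB: "A * B = 1\<^sub>m n" and AC: "A * C = 1\<^sub>m n"
  shows "B = C"
proof -
  have "B * A = 1\<^sub>m n" by (rule mat_mult_left_right_inverse[OF A B AB])
  then have "B * A * C = C" using C by simp
  then show ?thesis
    unfolding assoc_mult_mat[OF B A C] AC using B by simp
qed

lemma mat_tendsto_mat_delete:
  assumes "mat_tendsto X L" "L \<in> carrier_mat N N" "i < N" "j < N"
  shows "mat_tendsto (\<lambda>k. mat_delete (X k) i j) (mat_delete L i j)"
  unfolding mat_tendsto_def
proof (intro conjI allI impI)
  have ev: "\<forall>\<^sub>F k in sequentially. X k \<in> carrier_mat N N"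
    using assms by (auto simp: mat_tendsto_def)
  then show "\<forall>\<^sub>F k in sequentially. mat_delete (X k) i j
      \<in> carrier_mat (dim_row (mat_delete L i j)) (dim_col (mat_delete L i j))"
    by eventually_elim (use assms in \<open>auto simp: mat_delete_def\<close>)
  fix a b assume ab: "a < dim_row (mat_delete L i j)" "b < dim_col (mat_delete L i j)"
  \<comment> \<open>Positions in the full matrix: indices at or past the deleted row or column shift
    up by one.\<close>
  define a' where "a' = (if a < i then a else Suc a)"
  define b' where "b' = (if b < j then b else Suc b)"
  have "a' < N" "b' < N" using ab assms by (auto simp: a'_def b'_def mat_delete_def)
  then have "(\<lambda>k. X k $$ (a', b')) \<longlonglongrightarrow> L $$ (a', b')"
    using assms by (auto simp: mat_tendsto_def)
  moreover have "\<forall>\<^sub>F k in sequentially. X k $$ (a', b') = mat_delete (X k) i j $$ (a, b)"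
    using ev by eventually_elim (use assms ab in \<open>auto simp: mat_delete_def a'_def b'_def\<close>)
  moreover have "L $$ (a', b') = mat_delete L i j $$ (a, b)"
    using assms ab by (auto simp: mat_delete_def a'_def b'_def)
  ultimately show "(\<lambda>k. mat_delete (X k) i j $$ (a, b)) \<longlonglongrightarrow> mat_delete L i j $$ (a, b)"
    using Lim_transform_eventually by simp
qed

text \<open>Cramer's rule, which reduces continuity of inversion to continuity of
  determinants.\<close>

lemma inverse_eq_adj_mat:
  fixes A B :: "'a :: field mat"
  assumes A: "A \<in> carrier_mat N N" and B: "B \<in> carrier_mat N N" and AB: "A * B = 1\<^sub>m N"
  shows "B = (1 / det A) \<cdot>\<^sub>m adj_mat A"
proof (rule mat_inverse_unique[OF A B _ AB])
  have "det A \<noteq> 0" using arg_cong[OF AB, of det] det_mult[OF A B] by auto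
  then show "A * ((1 / det A) \<cdot>\<^sub>m adj_mat A) = 1\<^sub>m N"
    by (simp add: mult_smult_distrib[OF A adj_mat(1)[OF A]] adj_mat(2)[OF A]) (rule eq_matI; simp)
qed (use adj_mat[OF A] in auto)

text \<open>Entry (i, j) of \<open>Y k\<close> is the cofactor (j, i) of \<open>X k\<close> divided
  by \<open>det (X k)\<close>. Numerator and denominator converge, and the limit
  \<open>det L\<close> of the denominator is nonzero because \<open>L\<close> has an
  inverse.\<close>

lemma mat_tendsto_inverse:
  assumes X: "mat_tendsto X L" and L: "L \<in> carrier_mat N N" and K: "K \<in> carrier_mat N N"
    and LK: "L * K = 1\<^sub>m N"
    and inv: "\<forall>\<^sub>F k in sequentially. Y k \<in> carrier_mat N N \<and> X k * Y k = 1\<^sub>m N"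
  shows "mat_tendsto Y K"
  unfolding mat_tendsto_def
proof (intro conjI allI impI)
  have ev: "\<forall>\<^sub>F k in sequentially. X k \<in> carrier_mat N N"
    using assms by (auto simp: mat_tendsto_def)
  show "\<forall>\<^sub>F k in sequentially. Y k \<in> carrier_mat (dim_row K) (dim_col K)"
    using inv K by (auto elim: eventually_mono)
  fix i j assume ij: "i < dim_row K" "j < dim_col K"
  have d: "det L \<noteq> 0" using arg_cong[OF LK, of det] det_mult[OF L K] by auto
  have "mat_delete L j i \<in> carrier_mat (N - 1) (N - 1)"
    by (rule mat_delete_carrier[OF L])
  then have "(\<lambda>k. det (mat_delete (X k) j i)) \<longlonglongrightarrow> det (mat_delete L j i)"
    by (rule mat_tendsto_det[rotated]) (use mat_tendsto_mat_delete[OF X L] ij K in auto)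
  from tendsto_mult[OF tendsto_divide[OF tendsto_const mat_tendsto_det[OF X L] d]
      tendsto_mult[OF tendsto_const this]]
  have "(\<lambda>k. 1 / det (X k) * cofactor (X k) j i) \<longlonglongrightarrow> 1 / det L * cofactor L j i"
    unfolding cofactor_def .
  moreover have "\<forall>\<^sub>F k in sequentially. 1 / det (X k) * cofactor (X k) j i = Y k $$ (i, j)"
    using inv ev
  proof eventually_elim
    case (elim k)
    then show ?case using inverse_eq_adj_mat[of "X k" N "Y k"] ij K by (auto simp: adj_mat_def)
  qed
  moreover have "1 / det L * cofactor L j i = K $$ (i, j)"
    using inverse_eq_adj_mat[OF L K LK] ij K L by (auto simp: adj_mat_def)
  ultimately show "(\<lambda>k. Y k $$ (i, j)) \<longlonglongrightarrow> K $$ (i, j)"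
    using Lim_transform_eventually by simp
qed

subsection \<open>Choosing the unimodular scalar\<close>

text \<open>The determinant of the matrix \<open>P\<close> of linear polynomials evaluates at z to
  the determinant of the pencil. It is not the zero polynomial, since its value at 0 is
  \<open>det A\<close>.\<close>

lemma finite_roots_det_pencil:
  fixes A B :: "'a :: idom mat"
  assumes A: "A \<in> carrier_mat N N" and B: "B \<in> carrier_mat N N" and d: "det A \<noteq> 0"
  shows "finite {z. det (A + z \<cdot>\<^sub>m B) = 0}"
proof -
  define P where "P = mat N N (\<lambda>ij. [:A $$ ij, B $$ ij:])"
  have ev: "poly (det P) z = det (A + z \<cdot>\<^sub>m B)" for z
  proof -
    have hom: "comm_ring_hom (\<lambda>p :: 'a poly. poly p z)" by unfold_locales auto
    have "map_mat (\<lambda>p. poly p z) P = A + z \<cdot>\<^sub>m B"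
      by (rule eq_matI) (use A B in \<open>auto simp: P_def\<close>)
    then show ?thesis using comm_ring_hom.hom_det[OF hom, of P] by simp
  qed
  have "A + 0 \<cdot>\<^sub>m B = A" by (rule eq_matI) (use A B in auto)
  then have "det P \<noteq> 0" using ev[of 0] d by auto
  then show ?thesis using poly_roots_finite[of "det P"] by (simp add: ev)
qed

lemma exists_unit_notin_finite:
  assumes "finite F"
  shows "\<exists>z :: complex. cmod z = 1 \<and> z \<notin> F"
proof (rule ccontr)
  assume none: "\<not> ?thesis"
  \<comment> \<open>Pigeonhole: if F contained the whole unit circle, it would contain the card F +
    1 roots of unity of order card F + 1.\<close>
  have "{z. z ^ Suc (card F) = 1} \<subseteq> F"
  proof
    fix z :: complex assume "z \<in> {z. z ^ Suc (card F) = 1}"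
    then have z: "z ^ Suc (card F) = 1" by blast
    have "cmod z ^ Suc (card F) = 1 ^ Suc (card F)"
      unfolding norm_power[symmetric] z by (simp only: norm_one power_one)
    then have "cmod z = 1" by (rule power_inject_base) (simp_all only: norm_ge_zero zero_le_one)
    with none show "z \<in> F" by blast
  qed
  from card_mono[OF assms this] show False
    unfolding card_roots_unity_eq[OF zero_less_Suc] by simp
qed

lemma scalar_prod_mat_adjoint:
  fixes A :: "complex mat"
  assumes A: "A \<in> carrier_mat n m" and w: "w \<in> carrier_vec n" and v: "v \<in> carrier_vec m"
  shows "(mat_adjoint A *\<^sub>v w) \<bullet>c v = w \<bullet>c (A *\<^sub>v v)"
proof -
  have "(mat_adjoint A *\<^sub>v w) \<bullet>c v = (\<Sum>i = 0..<m. \<Sum>h = 0..<n. cnj (A $$ (h, i)) * w $ h * cnj (v $ i))"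
    using assms by (auto simp: scalar_prod_def sum_distrib_right intro!: sum.cong)
  also have "\<dots> = (\<Sum>h = 0..<n. \<Sum>i = 0..<m. cnj (A $$ (h, i)) * w $ h * cnj (v $ i))"
    by (rule sum.swap)
  also have "\<dots> = w \<bullet>c (A *\<^sub>v v)"
    using assms by (auto simp: scalar_prod_def sum_distrib_left mult_ac intro!: sum.cong)
  finally show ?thesis .
qed

text \<open>Pairing the Gram identity with a nonzero kernel vector v of A would give 0 = |v|^2 + |C
  v|^2 > 0.\<close>

lemma det_nonzero_of_gram_eq_one_plus_gram:
  fixes A C :: "complex mat"
  assumes A: "A \<in> carrier_mat n n" and C: "C \<in> carrier_mat n n"
    and gram: "mat_adjoint A * A = 1\<^sub>m n + mat_adjoint C * C"
  shows "det A \<noteq> 0"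
proof
  assume "det A = 0"
  then obtain v where v: "v \<in> carrier_vec n" "v \<noteq> 0\<^sub>v n" "A *\<^sub>v v = 0\<^sub>v n"
    using det_0_iff_vec_prod_zero[OF A] by blast
  have Cv: "C *\<^sub>v v \<in> carrier_vec n" using C v by auto
  have "(mat_adjoint A * A) *\<^sub>v v = mat_adjoint A *\<^sub>v 0\<^sub>v n"
    using A v by (simp add: assoc_mult_mat_vec[of _ n n _ n])
  also have "\<dots> = 0\<^sub>v n" using A by (intro eq_vecI) auto
  finally have "(1\<^sub>m n + mat_adjoint C * C) *\<^sub>v v = 0\<^sub>v n" unfolding gram .
  moreover have "(1\<^sub>m n + mat_adjoint C * C) *\<^sub>v v = v + mat_adjoint C *\<^sub>v (C *\<^sub>v v)"
    using C v by (simp add: add_mult_distrib_mat_vec[of _ n n] assoc_mult_mat_vec[of _ n n _ n]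
        mult_carrier_mat[of _ n n _ n])
  ultimately have "(v + mat_adjoint C *\<^sub>v (C *\<^sub>v v)) \<bullet>c v = 0" using v by simp
  moreover have "mat_adjoint C *\<^sub>v (C *\<^sub>v v) \<in> carrier_vec n"
    by (rule mult_mat_vec_carrier[OF mat_adjoint_carrier[OF C] Cv])
  ultimately have "v \<bullet>c v + (C *\<^sub>v v) \<bullet>c (C *\<^sub>v v) = 0"
    using v by (simp add: add_scalar_prod_distrib[of _ n] scalar_prod_mat_adjoint[OF C Cv v(1)])
  moreover have "v \<bullet>c v > 0" using v by simp
  moreover have "(C *\<^sub>v v) \<bullet>c (C *\<^sub>v v) \<ge> 0" using Cv by auto
  ultimately show False by (metis add_pos_nonneg less_irrefl)
qed

text \<open>The upper left block of the flat relation reads A^dagger A - B^T B^# = I, the minus sign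
  coming from J. The product B^T B^# is the Gram matrix of B^#, the form used in
  \<open>det_nonzero_of_gram_eq_one_plus_gram\<close>.\<close>

lemma Sp_Delta_gram:
  assumes A: "A \<in> carrier_mat n n" and B: "B \<in> carrier_mat n n"
    and inv: "mat_flat (Delta A B) * Delta A B = 1\<^sub>m (n + n)"
  shows "mat_adjoint A * A = 1\<^sub>m n + mat_adjoint (mat_conj B) * mat_conj B"
proof (rule eq_matI)
  have D: "Delta A B \<in> carrier_mat (n + n) (n + n)" using A B by (auto simp: Delta_def)
  fix i j assume "i < dim_row (1\<^sub>m n + mat_adjoint (mat_conj B) * mat_conj B)"
    and "j < dim_col (1\<^sub>m n + mat_adjoint (mat_conj B) * mat_conj B)"
  then have ij: "i < n" "j < n" using B by auto
  have split: "sum f {0..<n + n} = (\<Sum>h = 0..<n. f h) + (\<Sum>h = 0..<n. f (n + h))"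
    for f :: "nat \<Rightarrow> complex"
    using sum.atLeastLessThan_concat[of 0 n "n + n" f] sum.shift_bounds_nat_ivl[of f 0 n n]
    by (simp add: add.commute)
  have "(mat_flat (Delta A B) * Delta A B) $$ (i, j)
      = (\<Sum>h = 0..<n + n. mat_flat (Delta A B) $$ (i, h) * Delta A B $$ (h, j))"
    using D ij carrier_matD[OF mat_flat_carrier[OF D]] by (simp add: scalar_prod_def)
  also have "\<dots> = (\<Sum>h = 0..<n. mat_flat (Delta A B) $$ (i, h) * Delta A B $$ (h, j))
      + (\<Sum>h = 0..<n. mat_flat (Delta A B) $$ (i, n + h) * Delta A B $$ (n + h, j))"
    by (rule split)
  also have "\<dots> = (\<Sum>h = 0..<n. cnj (A $$ (h, i)) * A $$ (h, j))
      - (\<Sum>h = 0..<n. B $$ (h, i) * cnj (B $$ (h, j)))"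
    using A B ij by (simp add: index_mat_flat[OF D] sum_negf) (simp add: Delta_def)
  finally show "(mat_adjoint A * A) $$ (i, j)
      = (1\<^sub>m n + mat_adjoint (mat_conj B) * mat_conj B) $$ (i, j)"
    using A B ij by (simp add: inv scalar_prod_def)
qed (use A B in auto)

lemma exists_unit_det_nonzero:
  assumes A: "A \<in> carrier_mat n n" and B: "B \<in> carrier_mat n n" and d: "det A \<noteq> 0"
  shows "\<exists>z. cmod z = 1 \<and> det (Delta (z \<cdot>\<^sub>m 1\<^sub>m n) (0\<^sub>m n n) - Delta A B) \<noteq> 0"
proof -
  \<comment> \<open>\<open>P0 + z P1\<close> is \<open>\<Delta>(z I, 0) - \<Delta>(A, B)\<close> with its lower half multiplied by \<open>z\<close>, using \<open>z cnj z = 1\<close>.\<close>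
  define P0 where "P0 = four_block_mat (- A) (- B) (0\<^sub>m n n) (1\<^sub>m n)"
  define P1 where "P1 = four_block_mat (1\<^sub>m n) (0\<^sub>m n n) (- mat_conj B) (- mat_conj A)"
  have P: "P0 \<in> carrier_mat (n + n) (n + n)" "P1 \<in> carrier_mat (n + n) (n + n)"
    using A B by (auto simp: P0_def P1_def)
  \<comment> \<open>In this form the determinant of - A is (-1)^n det A, so the block triangular
    \<open>P0\<close>, the value of the pencil at z = 0, is nonsingular.\<close>
  have "- A = (- 1) \<cdot>\<^sub>m A" using A by (intro eq_matI) auto
  then have "det P0 \<noteq> 0"
    using A B d by (simp add: P0_def det_four_block_mat_lower_left_zero[of _ n _ n])
  from exists_unit_notin_finite[OF finite_roots_det_pencil[OF P this]]
  obtain z where z: "cmod z = 1" "det (P0 + z \<cdot>\<^sub>m P1) \<noteq> 0" by auto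
  define W where "W = Delta (z \<cdot>\<^sub>m 1\<^sub>m n) (0\<^sub>m n n) - Delta A B"
  define L where "L = four_block_mat (1\<^sub>m n) (0\<^sub>m n n) (0\<^sub>m n n) (z \<cdot>\<^sub>m 1\<^sub>m n)"
  have W: "W \<in> carrier_mat (n + n) (n + n)" and L: "L \<in> carrier_mat (n + n) (n + n)"
    using A B by (auto simp: W_def L_def Delta_def)
  have zz: "z * cnj z = 1" using z(1) by (simp flip: complex_norm_square)
  have Wb: "W = four_block_mat (z \<cdot>\<^sub>m 1\<^sub>m n - A) (- B) (- mat_conj B) (cnj z \<cdot>\<^sub>m 1\<^sub>m n - mat_conj A)"
    by (rule eq_matI) (use A B in \<open>auto simp: W_def Delta_def\<close>)
  have "L * W = four_block_mat (z \<cdot>\<^sub>m 1\<^sub>m n - A) (- B)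
      (z \<cdot>\<^sub>m - mat_conj B) (z \<cdot>\<^sub>m (cnj z \<cdot>\<^sub>m 1\<^sub>m n - mat_conj A))"
    unfolding L_def Wb using A B
    by (subst mult_four_block_mat[of _ n n _ n _ n _ _ n _ n])
      (auto simp: mult_smult_assoc_mat[of _ n n _ n] minus_carrier_mat[of _ n n])
  also have "\<dots> = P0 + z \<cdot>\<^sub>m P1"
    by (rule eq_matI) (use A B zz in \<open>auto simp: P0_def P1_def algebra_simps\<close>)
  finally have "det L * det W \<noteq> 0" using z(2) det_mult[OF L W] by simp
  with z(1) show ?thesis by (auto simp: W_def)
qed

subsection \<open>The Cayley transform\<close>

text \<open>Both W^flat W and D^flat W + W^flat D expand to 2 I - D^flat St - St^flat D, because D
  and St preserve the form given by J. Removing W and W^flat by means of V yields the claim.\<close>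

lemma cayley_flat_identity:
  fixes D St V :: "complex mat"
  defines "W \<equiv> D - St"
  assumes D: "D \<in> carrier_mat (n + n) (n + n)" and St: "St \<in> carrier_mat (n + n) (n + n)"
    and V: "V \<in> carrier_mat (n + n) (n + n)"
    and DD: "mat_flat D * D = 1\<^sub>m (n + n)" and SS: "mat_flat St * St = 1\<^sub>m (n + n)"
    and WV: "W * V = 1\<^sub>m (n + n)"
  shows "mat_flat (D * V) = 1\<^sub>m (n + n) - D * V"
proof -
  let ?N = "n + n"
  have W: "W \<in> carrier_mat ?N ?N" using D St by (auto simp: W_def)
  note c = D St V W mat_flat_carrier[OF D] mat_flat_carrier[OF St]
    mat_flat_carrier[OF V] mat_flat_carrier[OF W]
  note m = mult_carrier_mat[of _ ?N ?N _ ?N]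
  note a = assoc_mult_mat[of _ ?N ?N _ ?N _ ?N]
  have VW: "mat_flat V * mat_flat W = 1\<^sub>m ?N"
    using mat_flat_mult[OF W V] WV mat_flat_one by simp
  define X where "X = mat_flat D * St"
  define Y where "Y = mat_flat St * D"
  have XY: "X \<in> carrier_mat ?N ?N" "Y \<in> carrier_mat ?N ?N" unfolding X_def Y_def using c by (auto intro!: m)
  have DW: "mat_flat D * W = 1\<^sub>m ?N - X"
    using c DD by (simp add: W_def X_def mult_minus_distrib_mat[of _ ?N ?N _ ?N])
  have WD: "mat_flat W * D = 1\<^sub>m ?N - Y"
    using c DD by (simp add: W_def Y_def mat_flat_minus[of _ n n] minus_mult_distrib_mat[of _ ?N ?N _ _ ?N])
  have WS: "mat_flat W * St = X - 1\<^sub>m ?N"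
    using c SS by (simp add: W_def X_def mat_flat_minus[of _ n n] minus_mult_distrib_mat[of _ ?N ?N _ _ ?N])
  have "mat_flat W * W = mat_flat W * D - mat_flat W * St"
    using mult_minus_distrib_mat[OF mat_flat_carrier[OF W] D St] by (simp only: W_def[symmetric])
  also have "\<dots> = mat_flat D * W + mat_flat W * D"
    unfolding DW WD WS by (rule eq_matI) (use XY in auto)
  \<comment> \<open>Multiplying by \<open>V\<^sup>\<flat>\<close> on the left and by \<open>V\<close> on the right gives \<open>I = (D V)\<^sup>\<flat> + D V\<close>.\<close>
  finally have key: "mat_flat W * W = mat_flat D * W + mat_flat W * D" .
  have "1\<^sub>m ?N = mat_flat V * (mat_flat W * W) * V"
  proof -
    have "mat_flat V * (mat_flat W * W) * V = (mat_flat V * mat_flat W) * (W * V)"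
      using c by (simp add: a m)
    then show ?thesis by (simp add: VW WV)
  qed
  also have "\<dots> = mat_flat V * (mat_flat D * W) * V + mat_flat V * (mat_flat W * D) * V"
    unfolding key using c by (simp add: m mult_add_distrib_mat[of _ ?N ?N _ ?N] add_mult_distrib_mat[of _ ?N ?N _ _ ?N])
  also have "mat_flat V * (mat_flat D * W) * V = mat_flat V * mat_flat D * (W * V)"
    using c by (simp add: a m)
  also have "mat_flat V * (mat_flat W * D) * V = (mat_flat V * mat_flat W) * (D * V)"
    using c by (simp add: a m)
  also have "mat_flat V * mat_flat D = mat_flat (D * V)"
    using mat_flat_mult[OF D V] by simp
  finally have eq: "1\<^sub>m ?N = mat_flat (D * V) + D * V"
    by (simp add: VW WV left_mult_one_mat[OF m[OF D V]]
        right_mult_one_mat[OF mat_flat_carrier[OF m[OF D V]]])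
  show ?thesis
    unfolding eq using D V carrier_matD[OF mat_flat_carrier[OF m[OF D V]]]
    by (intro eq_matI) auto
qed

text \<open>\<open>mat_inverse\<close> can return \<open>None\<close> only for non-units, and the
  scaled adjugate shows that A is a unit when its determinant is nonzero.\<close>

lemma obtain_mat_inverse:
  fixes A :: "'a :: field mat"
  assumes A: "A \<in> carrier_mat N N" and d: "det A \<noteq> 0"
  obtains B where "B \<in> carrier_mat N N" "A * B = 1\<^sub>m N" "B * A = 1\<^sub>m N" "mat_inverse A = Some B"
    "invertible_mat A"
proof (cases "mat_inverse A")
  case None
  let ?B = "(1 / det A) \<cdot>\<^sub>m adj_mat A"
  have "A * ?B = 1\<^sub>m N" "?B * A = 1\<^sub>m N"
    using d by (simp_all add: mult_smult_distrib[OF A adj_mat(1)[OF A]] adj_mat(2,3)[OF A]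
        mult_smult_assoc_mat[OF adj_mat(1)[OF A] A]) (rule eq_matI; simp)+
  then have "A \<in> Units (ring_mat TYPE('a) N ())"
    using A adj_mat(1)[OF A] unfolding Units_def ring_mat_def
    by (auto intro!: bexI[of _ ?B])
  with mat_inverse(1)[OF A None, of "()"] show thesis by blast
next
  case (Some B)
  from mat_inverse(2)[OF A this] have "A * B = 1\<^sub>m N" "B * A = 1\<^sub>m N" "B \<in> carrier_mat N N"
    by auto
  then have "invertible_mat A"
    using A by (auto simp: invertible_mat_def inverts_mat_def)
  with Some that mat_inverse(2)[OF A Some] show thesis by blast
qed

subsection \<open>The approximating systems\<close>

text \<open>The scalar is real because the lower right block of \<open>Delta\<close> is the
  conjugate of the upper left one.\<close>

lemma smult_one_eq_Delta:
  "complex_of_real c \<cdot>\<^sub>m 1\<^sub>m (n + n) = Delta (complex_of_real c \<cdot>\<^sub>m 1\<^sub>m n) (0\<^sub>m n n)"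
  by (rule eq_matI) (auto simp: Delta_def)

lemma Delta_smult_of_real:
  assumes "A \<in> carrier_mat n n" "B \<in> carrier_mat n n"
  shows "Delta (complex_of_real c \<cdot>\<^sub>m A) (complex_of_real c \<cdot>\<^sub>m B) = complex_of_real c \<cdot>\<^sub>m Delta A B"
  by (rule eq_matI) (use assms in \<open>auto simp: Delta_def\<close>)

lemma scalar_unitary:
  assumes "cmod z = 1"
  shows "z \<cdot>\<^sub>m 1\<^sub>m n \<in> unitary_matrices n"
proof -
  have zz: "z * cnj z = 1" using assms by (simp flip: complex_norm_square)
  have adj: "mat_adjoint (z \<cdot>\<^sub>m 1\<^sub>m n) = cnj z \<cdot>\<^sub>m 1\<^sub>m n" by (rule eq_matI) auto
  have "mat_adjoint (z \<cdot>\<^sub>m 1\<^sub>m n) * (z \<cdot>\<^sub>m 1\<^sub>m n) = (cnj z * z) \<cdot>\<^sub>m 1\<^sub>m n"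
    "(z \<cdot>\<^sub>m 1\<^sub>m n) * mat_adjoint (z \<cdot>\<^sub>m 1\<^sub>m n) = (z * cnj z) \<cdot>\<^sub>m 1\<^sub>m n"
    unfolding adj by (auto simp: mult_smult_distrib[of _ n n _ n] mult_smult_assoc_mat[of _ n n _ n] intro!: eq_matI)
  moreover have "(1 :: complex) \<cdot>\<^sub>m 1\<^sub>m n = 1\<^sub>m n" by (rule eq_matI) auto
  ultimately show ?thesis using zz by (simp add: unitary_matrices_def mult.commute)
qed

text \<open>On a block diagonal matrix the signs in \<open>mat_flat\<close> cancel, so the flat of D
  has the blocks cnj z I and z I, and |z| = 1 gives the inverse.\<close>

lemma Delta_unitary_scalar_flat:
  fixes n :: nat and z :: complex
  assumes "cmod z = 1"
  defines "D \<equiv> Delta (z \<cdot>\<^sub>m 1\<^sub>m n) (0\<^sub>m n n)"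
  shows "mat_flat D * D = 1\<^sub>m (n + n)" "D * mat_flat D = 1\<^sub>m (n + n)"
proof -
  have zz: "z * cnj z = 1" using assms by (simp flip: complex_norm_square)
  have D: "D \<in> carrier_mat (n + n) (n + n)" by (auto simp: D_def Delta_def)
  have flat: "mat_flat D = Delta (cnj z \<cdot>\<^sub>m 1\<^sub>m n) (0\<^sub>m n n)"
  proof (rule eq_matI)
    fix i j assume "i < dim_row (Delta (cnj z \<cdot>\<^sub>m 1\<^sub>m n) (0\<^sub>m n n))"
      and "j < dim_col (Delta (cnj z \<cdot>\<^sub>m 1\<^sub>m n) (0\<^sub>m n n))"
    then have ij: "i < n + n" "j < n + n" by (auto simp: Delta_def)
    show "mat_flat D $$ (i, j) = Delta (cnj z \<cdot>\<^sub>m 1\<^sub>m n) (0\<^sub>m n n) $$ (i, j)"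
      unfolding index_mat_flat[OF D ij] using ij by (auto simp: D_def Delta_def)
  qed (use carrier_matD[OF mat_flat_carrier[OF D]] in \<open>auto simp: Delta_def\<close>)
  have *: "Delta (a \<cdot>\<^sub>m 1\<^sub>m n) (0\<^sub>m n n) * Delta (b \<cdot>\<^sub>m 1\<^sub>m n) (0\<^sub>m n n) = 1\<^sub>m (n + n)"
    if "a * b = 1" for a b
  proof -
    have ab: "cnj a * cnj b = 1" using that by (metis complex_cnj_mult complex_cnj_one)
    have conj: "mat_conj (c \<cdot>\<^sub>m 1\<^sub>m n) = cnj c \<cdot>\<^sub>m 1\<^sub>m n" "mat_conj (0\<^sub>m n n) = 0\<^sub>m n n" for c
      by (rule eq_matI; simp)+
    have "Delta (a \<cdot>\<^sub>m 1\<^sub>m n) (0\<^sub>m n n) * Delta (b \<cdot>\<^sub>m 1\<^sub>m n) (0\<^sub>m n n)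
        = four_block_mat (1\<^sub>m n) (0\<^sub>m n n) (0\<^sub>m n n) (1\<^sub>m n)"
      unfolding Delta_def conj
      by (subst mult_four_block_mat[of _ n n _ n _ n _ _ n _ n])
        (auto simp: mult_smult_distrib[of _ n n _ n] mult_smult_assoc_mat[of _ n n _ n]
          that ab mult.commute[of b] mult.commute[of "cnj b"] intro!: cong_four_block_mat eq_matI)
    then show ?thesis by simp
  qed
  show "mat_flat D * D = 1\<^sub>m (n + n)" "D * mat_flat D = 1\<^sub>m (n + n)"
    unfolding flat by (simp_all add: D_def * zz mult.commute)
qed

text \<open>With D = Delta(z I, 0) and M = D (D - St)^-1, take Z = M - I/2 and N = (D - St) D^flat.
  Then N inverts M, and N D = D - St makes D - N D equal to St.\<close>

lemma exists_skew_generator: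
  assumes St: "doubled_up n St" and SS: "mat_flat St * St = 1\<^sub>m (n + n)"
  obtains z Z N where "cmod z = 1" "doubled_up n Z" "mat_flat Z = - Z"
    "N \<in> carrier_mat (n + n) (n + n)" "((1/2) \<cdot>\<^sub>m 1\<^sub>m (n + n) + Z) * N = 1\<^sub>m (n + n)"
    "Delta (z \<cdot>\<^sub>m 1\<^sub>m n) (0\<^sub>m n n) - N * Delta (z \<cdot>\<^sub>m 1\<^sub>m n) (0\<^sub>m n n) = St"
proof -
  let ?N = "n + n" and ?I = "1\<^sub>m (n + n) :: complex mat"
  obtain A B where AB: "A \<in> carrier_mat n n" "B \<in> carrier_mat n n" "St = Delta A B"
    using doubled_upE[OF St] .
  have Bc: "mat_conj B \<in> carrier_mat n n" using AB by simp
  have "det A \<noteq> 0"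
    by (rule det_nonzero_of_gram_eq_one_plus_gram[OF AB(1) Bc])
      (use Sp_Delta_gram[OF AB(1,2)] SS AB(3) in simp)
  from exists_unit_det_nonzero[OF AB(1,2) this] obtain z where
    z: "cmod z = 1" "det (Delta (z \<cdot>\<^sub>m 1\<^sub>m n) (0\<^sub>m n n) - St) \<noteq> 0" unfolding AB(3) by blast
  define D where "D = Delta (z \<cdot>\<^sub>m 1\<^sub>m n) (0\<^sub>m n n)"
  define W where "W = D - St"
  have Dd: "doubled_up n D" unfolding D_def by (rule doubled_up_Delta) auto
  have Wd: "doubled_up n W" unfolding W_def by (rule doubled_up_minus[OF Dd St])
  have D: "D \<in> carrier_mat ?N ?N" and W: "W \<in> carrier_mat ?N ?N" and S: "St \<in> carrier_mat ?N ?N"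
    using Dd Wd St by (auto simp: doubled_up_def)
  note DD = Delta_unitary_scalar_flat[OF z(1), of n, folded D_def]
  obtain V where V: "V \<in> carrier_mat ?N ?N" "W * V = ?I" "V * W = ?I"
    using obtain_mat_inverse[OF W] z(2) by (auto simp: W_def D_def)
  define M where "M = D * V"
  \<comment> \<open>The matrix I/2 is fixed by the flat involution, so subtracting it turns M +
    M^flat = I into skewness of Z.\<close>
  define Z where "Z = M - (1/2) \<cdot>\<^sub>m ?I"
  have Md: "doubled_up n M"
    unfolding M_def by (rule doubled_up_mult[OF Dd doubled_up_inverse[OF Wd V]])
  then have M: "M \<in> carrier_mat ?N ?N" by (simp add: doubled_up_def)
  have half: "doubled_up n ((1/2) \<cdot>\<^sub>m ?I)"
    using smult_one_eq_Delta[of "1/2" n] doubled_up_Delta[of "complex_of_real (1/2) \<cdot>\<^sub>m 1\<^sub>m n" n "0\<^sub>m n n"]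
    by simp
  have Zd: "doubled_up n Z" unfolding Z_def by (rule doubled_up_minus[OF Md half])
  have "mat_flat M = ?I - M"
    unfolding M_def by (rule cayley_flat_identity[OF D S V(1) DD(1) SS]) (use V(2) in \<open>simp add: W_def\<close>)
  then have "mat_flat Z = - Z"
    unfolding Z_def using M
    by (simp add: mat_flat_minus[of _ n n] mat_flat_smult[of _ n n] mat_flat_one) (rule eq_matI; auto)
  moreover have "(1/2) \<cdot>\<^sub>m ?I + Z = M"
    unfolding Z_def using M by (intro eq_matI) auto
  moreover have fD: "mat_flat D \<in> carrier_mat ?N ?N" using D by simp
  moreover have "M * (W * mat_flat D) = ?I"
  proof -
    have "M * (W * mat_flat D) = D * (V * W) * mat_flat D"
      unfolding M_def using D V(1) W fD
      by (simp add: assoc_mult_mat[of _ ?N ?N _ ?N _ ?N] mult_carrier_mat[of _ ?N ?N _ ?N])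
    then show ?thesis using D by (simp add: V DD)
  qed
  moreover have "D - W * mat_flat D * D = St"
  proof -
    have "W * mat_flat D * D = W" unfolding assoc_mult_mat[OF W fD D] DD(1) using W by simp
    then show ?thesis unfolding W_def using D S by (auto intro!: eq_matI)
  qed
  moreover have "W * mat_flat D \<in> carrier_mat ?N ?N" using W fD by (rule mult_carrier_mat)
  ultimately show thesis
    using that[OF z(1) Zd, of "W * mat_flat D"] by (simp add: D_def)
qed

text \<open>The coupling enters the drift matrix quadratically and the Hamiltonian linearly, so the
  weights sqrt k and k give the drift -k (I/2 + Z): damping and Hamiltonian grow at the same
  rate.\<close>

definition scaled_system :: "nat \<Rightarrow> complex \<Rightarrow> complex mat \<Rightarrow> nat \<Rightarrow> hp_system" where
  "scaled_system n z Z k = (z \<cdot>\<^sub>m 1\<^sub>m n, complex_of_real (sqrt (real k)) \<cdot>\<^sub>m 1\<^sub>m (n + n),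
     (- \<i> * of_nat k) \<cdot>\<^sub>m Z)"

lemma scaled_system_in_LHP:
  assumes n: "n \<ge> 1" and z: "cmod z = 1" and Z: "doubled_up n Z" and skew: "mat_flat Z = - Z"
  shows "scaled_system n z Z k \<in> LHP n"
proof -
  obtain P Q where PQ: "P \<in> carrier_mat n n" "Q \<in> carrier_mat n n" "Z = Delta P Q"
    using doubled_upE[OF Z] .
  note sk = mat_adjoint_eq_neg_flat_Delta[OF PQ(1,2) skew[unfolded PQ(3)]]
  \<comment> \<open>The factor - i turns the skew-Hermitian block P into a Hermitian one and keeps Q
    symmetric.\<close>
  let ?P = "(- \<i> * of_nat k) \<cdot>\<^sub>m P" and ?Q = "(- \<i> * of_nat k) \<cdot>\<^sub>m Q"
  have "mat_adjoint ?P = (\<i> * of_nat k) \<cdot>\<^sub>m mat_adjoint P"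
    by (rule eq_matI) (use PQ in auto)
  also have "\<dots> = ?P" unfolding sk by (rule eq_matI) (use PQ in auto)
  finally have P: "mat_adjoint ?P = ?P" .
  have "transpose_mat ?Q = (- \<i> * of_nat k) \<cdot>\<^sub>m transpose_mat Q" by (rule eq_matI) auto
  then have Q: "transpose_mat ?Q = ?Q" unfolding sk .
  \<comment> \<open>The factor i in the definition of \<open>LHP_modes\<close> cancels - i before
    \<open>Delta\<close> conjugates, so only the real scalar k has to be pulled out.\<close>
  have "\<i> \<cdot>\<^sub>m ?P = complex_of_real (real k) \<cdot>\<^sub>m P" "\<i> \<cdot>\<^sub>m ?Q = complex_of_real (real k) \<cdot>\<^sub>m Q"
    by (rule eq_matI; simp flip: mult.assoc)+
  then have "Delta (\<i> \<cdot>\<^sub>m ?P) (\<i> \<cdot>\<^sub>m ?Q) = complex_of_real (real k) \<cdot>\<^sub>m Z"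
    using Delta_smult_of_real[OF PQ(1,2), of "real k"] PQ(3) by simp
  then have Om: "(- \<i>) \<cdot>\<^sub>m ((- \<i> * of_nat k) \<cdot>\<^sub>m Z) = - Delta (\<i> \<cdot>\<^sub>m ?P) (\<i> \<cdot>\<^sub>m ?Q)"
    by (intro eq_matI) (auto simp flip: mult.assoc)
  \<comment> \<open>There are as many modes as channels, so a multiple of the identity is an
    admissible coupling; n >= 1 then places the system in the union over m >= 1.\<close>
  have "scaled_system n z Z k \<in> LHP_modes n n"
    unfolding scaled_system_def LHP_modes_def
  proof (clarify, intro conjI)
    show "\<exists>Cm\<in>carrier_mat n n. \<exists>Cp\<in>carrier_mat n n.
        complex_of_real (sqrt (real k)) \<cdot>\<^sub>m 1\<^sub>m (n + n) = Delta Cm Cp"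
      unfolding smult_one_eq_Delta by (intro bexI refl) auto
    show "\<exists>Om_m\<in>carrier_mat n n. \<exists>Om_p\<in>carrier_mat n n. mat_adjoint Om_m = Om_m
        \<and> transpose_mat Om_p = Om_p
        \<and> (- \<i>) \<cdot>\<^sub>m ((- \<i> * of_nat k) \<cdot>\<^sub>m Z) = - Delta (\<i> \<cdot>\<^sub>m Om_m) (\<i> \<cdot>\<^sub>m Om_p)"
      by (rule bexI[of _ ?P], rule bexI[of _ ?Q]) (use P Q Om PQ in auto)
  qed (rule scalar_unitary[OF z])
  with n show ?thesis by (auto simp: LHP_def)
qed

lemma resolvent_arg_scaled_system:
  assumes Z: "Z \<in> carrier_mat (n + n) (n + n)"
  shows "resolvent_arg (scaled_system n z Z k) s
    = s \<cdot>\<^sub>m 1\<^sub>m (n + n) + of_nat k \<cdot>\<^sub>m ((1/2) \<cdot>\<^sub>m 1\<^sub>m (n + n) + Z)"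
proof -
  let ?I = "1\<^sub>m (n + n) :: complex mat"
  have "mat_flat (complex_of_real (sqrt (real k)) \<cdot>\<^sub>m ?I) = complex_of_real (sqrt (real k)) \<cdot>\<^sub>m ?I"
    by (simp add: mat_flat_smult[of _ n n] mat_flat_one)
  moreover have "complex_of_real (sqrt (real k)) \<cdot>\<^sub>m ?I * (complex_of_real (sqrt (real k)) \<cdot>\<^sub>m ?I)
      = of_nat k \<cdot>\<^sub>m ?I"
    by (rule eq_matI) (auto simp: mult_smult_distrib[of _ "n + n" "n + n" _ "n + n"]
        mult_smult_assoc_mat[of _ "n + n" "n + n" _ "n + n"] simp flip: of_real_mult)
  ultimately have A: "A_mat (scaled_system n z Z k) = (- (1/2)) \<cdot>\<^sub>m (of_nat k \<cdot>\<^sub>m ?I) - \<i> \<cdot>\<^sub>m ((- \<i> * of_nat k) \<cdot>\<^sub>m Z)"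
    by (simp add: scaled_system_def)
  show ?thesis
    unfolding resolvent_arg_def A by (rule eq_matI) (use Z in \<open>auto simp: algebra_simps\<close>)
qed

lemma transfer_scaled_system:
  assumes B: "B \<in> carrier_mat (n + n) (n + n)"
    and inv: "mat_inverse (resolvent_arg (scaled_system n z Z k) s) = Some B"
  shows "transfer (scaled_system n z Z k) s = Delta (z \<cdot>\<^sub>m 1\<^sub>m n) (0\<^sub>m n n)
    - (of_nat k \<cdot>\<^sub>m B) * Delta (z \<cdot>\<^sub>m 1\<^sub>m n) (0\<^sub>m n n)"
proof -
  let ?I = "1\<^sub>m (n + n) :: complex mat" and ?c = "complex_of_real (sqrt (real k))"
  have "mat_flat (?c \<cdot>\<^sub>m ?I) = ?c \<cdot>\<^sub>m ?I"
    by (simp add: mat_flat_smult[of _ n n] mat_flat_one)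
  moreover have "?c \<cdot>\<^sub>m ?I * B * (?c \<cdot>\<^sub>m ?I) = of_nat k \<cdot>\<^sub>m B"
    by (rule eq_matI) (use B in \<open>auto simp: mult_smult_distrib[of _ "n + n" "n + n" _ "n + n"]
        mult_smult_assoc_mat[of _ "n + n" "n + n" _ "n + n"] simp flip: mult.assoc of_real_mult\<close>)
  ultimately show ?thesis
    using inv by (simp add: scaled_system_def Let_def)
qed

text \<open>Dividing sI - A by k leaves (s/k) I + M with M = I/2 + Z, which tends to the invertible
  M. The factor k produced by the two couplings absorbs this division, so the transfer function
  becomes D - ((s/k) I + M)^-1 D.\<close>

lemma scaled_system_limit:
  assumes Z: "Z \<in> carrier_mat (n + n) (n + n)" and N: "N \<in> carrier_mat (n + n) (n + n)"
    and inv: "((1/2) \<cdot>\<^sub>m 1\<^sub>m (n + n) + Z) * N = 1\<^sub>m (n + n)"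
  shows "\<forall>\<^sub>F k in sequentially. transfer_defined (scaled_system n z Z k) s"
    and "mat_tendsto (\<lambda>k. transfer (scaled_system n z Z k) s)
      (Delta (z \<cdot>\<^sub>m 1\<^sub>m n) (0\<^sub>m n n) - N * Delta (z \<cdot>\<^sub>m 1\<^sub>m n) (0\<^sub>m n n))"
proof -
  let ?N = "n + n" and ?I = "1\<^sub>m (n + n) :: complex mat"
  define D where "D = Delta (z \<cdot>\<^sub>m 1\<^sub>m n) (0\<^sub>m n n)"
  define M where "M = (1/2) \<cdot>\<^sub>m ?I + Z"
  \<comment> \<open>At k = 0 the quotient s/0 is 0 by convention; the relation between
    \<open>R k\<close> and \<open>X k\<close> is therefore stated for k > 0.\<close>
  define X where "X k = (s / of_nat k) \<cdot>\<^sub>m ?I + M" for k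
  define R where "R k = resolvent_arg (scaled_system n z Z k) s" for k
  have D: "D \<in> carrier_mat ?N ?N" by (auto simp: D_def Delta_def)
  have M: "M \<in> carrier_mat ?N ?N" using Z by (simp add: M_def)
  have MN: "M * N = ?I" using inv by (simp add: M_def)
  have X: "X k \<in> carrier_mat ?N ?N" for k using M by (simp add: X_def)
  have R: "R k = of_nat k \<cdot>\<^sub>m X k" if "k > 0" for k
    unfolding R_def resolvent_arg_scaled_system[OF Z] X_def M_def[symmetric]
    by (rule eq_matI) (use that M in \<open>auto simp: field_simps\<close>)
  have lim: "mat_tendsto X M"
    unfolding mat_tendsto_def
  proof (intro conjI allI impI)
    show "\<forall>\<^sub>F k in sequentially. X k \<in> carrier_mat (dim_row M) (dim_col M)"
      using X M by simp
    fix i j assume ij: "i < dim_row M" "j < dim_col M"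
    have "(\<lambda>k. s / of_nat k * ?I $$ (i, j) + M $$ (i, j)) \<longlonglongrightarrow> 0 * ?I $$ (i, j) + M $$ (i, j)"
      by (intro tendsto_intros lim_const_over_n)
    then show "(\<lambda>k. X k $$ (i, j)) \<longlonglongrightarrow> M $$ (i, j)"
      using ij M by (simp add: X_def)
  qed
  have dM: "det M \<noteq> 0" using arg_cong[OF MN, of det] det_mult[OF M N] by auto
  define Y where "Y k = of_nat k \<cdot>\<^sub>m the (mat_inverse (R k))" for k
  \<comment> \<open>Since det (X k) tends to det M, which is nonzero, \<open>X k\<close> and hence
    \<open>R k\<close> is invertible for all large k. The bound on k may depend on s.\<close>
  have ev: "\<forall>\<^sub>F k in sequentially. transfer_defined (scaled_system n z Z k) s
      \<and> Y k \<in> carrier_mat ?N ?N \<and> X k * Y k = ?I \<and> D - Y k * D = transfer (scaled_system n z Z k) s"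
    using tendsto_imp_eventually_ne[OF mat_tendsto_det[OF lim M] dM] eventually_gt_at_top[of 0]
  proof eventually_elim
    case (elim k)
    have Rk: "R k \<in> carrier_mat ?N ?N" using R elim X by simp
    have "det (R k) \<noteq> 0" using elim X[of k] by (simp add: R)
    then obtain B where B: "B \<in> carrier_mat ?N ?N" "R k * B = ?I" "mat_inverse (R k) = Some B"
      "invertible_mat (R k)"
      using obtain_mat_inverse[OF Rk] by metis
    have "Y k = of_nat k \<cdot>\<^sub>m B" by (simp add: Y_def B(3))
    then have "X k * Y k = R k * B"
      using elim by (simp add: R mult_smult_distrib[OF X B(1)] mult_smult_assoc_mat[OF X B(1)])
    moreover have "D - Y k * D = transfer (scaled_system n z Z k) s"
      using transfer_scaled_system[OF B(1) B(3)[unfolded R_def]] by (simp add: D_def Y_def B(3))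
    ultimately show ?case
      using B by (simp add: transfer_defined_def R_def Y_def)
  qed
  then show "\<forall>\<^sub>F k in sequentially. transfer_defined (scaled_system n z Z k) s"
    by eventually_elim simp
  have "mat_tendsto Y N"
    by (rule mat_tendsto_inverse[OF lim M N MN]) (use ev in eventually_elim, simp)
  then have "mat_tendsto (\<lambda>k. D - Y k * D) (D - N * D)"
    using D N by (intro mat_tendsto_minus[of _ _ _ _ ?N ?N] mat_tendsto_mult[of _ _ _ _ ?N ?N ?N]) auto
  then show "mat_tendsto (\<lambda>k. transfer (scaled_system n z Z k) s)
      (Delta (z \<cdot>\<^sub>m 1\<^sub>m n) (0\<^sub>m n n) - N * Delta (z \<cdot>\<^sub>m 1\<^sub>m n) (0\<^sub>m n n))"
    unfolding D_def[symmetric] by (rule mat_tendsto_cong) (use ev in eventually_elim, simp)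
qed

theorem mainTheorem7:
  fixes n :: nat and St :: "complex mat"
  assumes "n \<ge> 1" and "St \<in> Sp n"
  shows "\<exists>G :: nat \<Rightarrow> hp_system. (\<forall>k \<ge> 1. G k \<in> LHP n) \<and>
    (\<forall>s :: complex. (\<forall>\<^sub>F k in sequentially. transfer_defined (G k) s) \<and>
       mat_tendsto (\<lambda>k. transfer (G k) s) St)"
proof -
  have St: "doubled_up n St" "mat_flat St * St = 1\<^sub>m (n + n)"
    using assms(2) doubled_up_Delta by (auto simp: Sp_def mult_2)
  obtain z Z N where z: "cmod z = 1" and Z: "doubled_up n Z" "mat_flat Z = - Z"
    and N: "N \<in> carrier_mat (n + n) (n + n)" "((1/2) \<cdot>\<^sub>m 1\<^sub>m (n + n) + Z) * N = 1\<^sub>m (n + n)"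
    and eq: "Delta (z \<cdot>\<^sub>m 1\<^sub>m n) (0\<^sub>m n n) - N * Delta (z \<cdot>\<^sub>m 1\<^sub>m n) (0\<^sub>m n n) = St"
    using exists_skew_generator[OF St] .
  have "Z \<in> carrier_mat (n + n) (n + n)" using Z by (simp add: doubled_up_def)
  \<comment> \<open>The systems do not involve s, so a single sequence serves all s at once.\<close>
  from scaled_system_limit[OF this N, of z] scaled_system_in_LHP[OF assms(1) z Z]
  show ?thesis
    unfolding eq by (intro exI[of _ "scaled_system n z Z"]) blast
qed

end
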